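(* The Gaussian and mean curvatures of an admissible helicoidal surface of ni-type in $\mathbb{I}^3$, $$Y_2(u,t)=(x(u)\cos(t\phi)-y(u)\sin(t\phi),\ x(u)\sin(t\phi)+y(u)\cos(t\phi),\ ct),$$ with $C^2$ generating curve $\alpha(u)=(x(u),y(u),0)$, are respectively $$K=\frac{c^2}{\phi^2}\,\frac{(x'y-xy')(x''y'-x'y'')-(x'^2+y'^2)^2}{(xx'+yy')^4}$$ and $$H=\frac{c}{\phi}\,\frac{(x^2+y^2)(x''y'-x'y'')+(x'^2+y'^2)(xy'-x'y)}{2(xx'+yy')^3}.$$
   Context: Here $c,\phi\in\mathbb{R}$ are constants, and primes denote $d/du$. The simply isotropic space $\mathbb{I}^3$ is $\mathbb{R}^3$ with the degenerate metric $\langle u,v\rangle_z=u^1v^1+u^2v^2$. For a $C^2$ parameterized surface $\mathbf{x}(u^1,u^2)=(x^1,x^2,x^3)$ write $\mathbf{x}_i=\partial\mathbf{x}/\partial u^i$, $\mathbf{x}_{ij}=\partial^2\mathbf{x}/\partial u^i\partial u^j$, $x^i_k=\partial x^i/\partial u^k$, $X_{ij}=x^i_1x^j_2-x^j_1x^i_2$. The surface is admissible if $X_{12}\neq0$ (equivalently, the induced metric has rank 2). Put $g_{ij}=\langle\mathbf{x}_i,\mathbf{x}_j\rangle_z$, $N_h=\left(\frac{X_{23}}{X_{12}},\frac{X_{31}}{X_{12}},1\right)$, $h_{ij}=\langle N_h,\mathbf{x}_{ij}\rangle$ (Euclidean inner product). The Gaussian and mean curvatures are $$K=\frac{h_{11}h_{22}-h_{12}^2}{g_{11}g_{22}-g_{12}^2},\qquad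 H=\frac12\,\frac{g_{11}h_{22}-2g_{12}h_{12}+g_{22}h_{11}}{g_{11}g_{22}-g_{12}^2};$$ equivalently $K=\det L$, $H=\frac12\mathrm{tr}\,L$ with $L=-D\xi$, $\xi=\left(A,B,\frac12(1-A^2-B^2)\right)$, $A=X_{23}/X_{12}$, $B=X_{31}/X_{12}$. For the surface in the claim the coordinates are $(u^1,u^2)=(u,t)$. *)

theory Defs
  imports "HOL-Analysis.Analysis"
begin

text \<open>Both derivatives are two-sided, so this is meant for open \<open>S\<close>.\<close>

definition C2_on :: "(real \<Rightarrow> 'a::real_normed_vector) \<Rightarrow> real set \<Rightarrow> bool" where
  "C2_on f S \<longleftrightarrow> f C1_differentiable_on S \<and>
     (\<lambda>s. vector_derivative f (at s)) C1_differentiable_on S"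

definition isotropic_inner :: "real^3 \<Rightarrow> real^3 \<Rightarrow> real" where
  "isotropic_inner v w = v $ 1 * w $ 1 + v $ 2 * w $ 2"

text \<open>A parameterized surface is a curried map \<open>X\<close> of the two parameters. Coordinate
  directions are indexed by the type \<open>2\<close>, in which \<open>2 = 0 \<noteq> 1\<close>; components of
  points are indexed by the type \<open>3\<close>.\<close>

type_synonym surface = "real \<Rightarrow> real \<Rightarrow> real^3"

definition partial :: "2 \<Rightarrow> surface \<Rightarrow> surface" where
  "partial i X = (\<lambda>u v. if i = 1 then vector_derivative (\<lambda>s. X s v) (at u)
                         else vector_derivative (\<lambda>s. X u s) (at v))"

definition minor2 :: "surface \<Rightarrow> 3 \<Rightarrow> 3 \<Rightarrow> real \<Rightarrow> real \<Rightarrow> real" where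
  "minor2 X i j u v =
     partial 1 X u v $ i * partial 2 X u v $ j - partial 1 X u v $ j * partial 2 X u v $ i"

definition admissible_on :: "surface \<Rightarrow> (real \<times> real) set \<Rightarrow> bool" where
  "admissible_on X D \<longleftrightarrow> (\<forall>(u, v) \<in> D. minor2 X 1 2 u v \<noteq> 0)"

definition fund_g :: "surface \<Rightarrow> 2 \<Rightarrow> 2 \<Rightarrow> real \<Rightarrow> real \<Rightarrow> real" where
  "fund_g X i j u v = isotropic_inner (partial i X u v) (partial j X u v)"

definition normal_h :: "surface \<Rightarrow> surface" where
  "normal_h X u v =
     vector [minor2 X 2 3 u v / minor2 X 1 2 u v, minor2 X 3 1 u v / minor2 X 1 2 u v, 1]"

definition fund_h :: "surface \<Rightarrow> 2 \<Rightarrow> 2 \<Rightarrow> real \<Rightarrow> real \<Rightarrow> real" where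
  "fund_h X i j u v = inner (normal_h X u v) (partial i (partial j X) u v)"

definition gauss_curvature :: "surface \<Rightarrow> real \<Rightarrow> real \<Rightarrow> real" where
  "gauss_curvature X u v =
     (fund_h X 1 1 u v * fund_h X 2 2 u v - (fund_h X 1 2 u v)\<^sup>2) /
     (fund_g X 1 1 u v * fund_g X 2 2 u v - (fund_g X 1 2 u v)\<^sup>2)"

definition mean_curvature :: "surface \<Rightarrow> real \<Rightarrow> real \<Rightarrow> real" where
  "mean_curvature X u v = 1 / 2 *
     ((fund_g X 1 1 u v * fund_h X 2 2 u v - 2 * fund_g X 1 2 u v * fund_h X 1 2 u v
        + fund_g X 2 2 u v * fund_h X 1 1 u v) /
      (fund_g X 1 1 u v * fund_g X 2 2 u v - (fund_g X 1 2 u v)\<^sup>2))"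

definition generating_curve :: "(real \<Rightarrow> real) \<Rightarrow> (real \<Rightarrow> real) \<Rightarrow> real \<Rightarrow> real^3" where
  "generating_curve x y u = vector [x u, y u, 0]"

definition helicoidal_ni ::
  "real \<Rightarrow> real \<Rightarrow> (real \<Rightarrow> real) \<Rightarrow> (real \<Rightarrow> real) \<Rightarrow> surface" where
  "helicoidal_ni c \<phi> x y u t =
     vector [x u * cos (t * \<phi>) - y u * sin (t * \<phi>),
             x u * sin (t * \<phi>) + y u * cos (t * \<phi>),
             c * t]"

end

theory Submission
  imports Defs
begin

text \<open>
  Write \<open>R\<close> for the rotation of the plane by the angle \<open>t * \<phi>\<close> and \<open>\<beta> = (x, y)\<close> for the
  generating curve. The surface is \<open>(R \<beta>, c * t)\<close>, and differentiating the planar part \<open>R \<beta>\<close> in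
  \<open>t\<close> merely rotates it by a further right angle and multiplies it by \<open>\<phi>\<close>. Hence the planar parts of all first and
  second partial derivatives are \<open>R\<close> applied to vectors built from \<open>\<beta>\<close>, \<open>\<beta>'\<close>, \<open>\<beta>''\<close>. The
  third coordinates contribute the constant \<open>c\<close> in the direction of \<open>t\<close> and zero otherwise; in
  particular the second derivatives are planar.

  The isotropic metric sees planar parts only, and the planar part of the normal is \<open>R \<beta>'\<close> turned
  by a right angle, up to the factor \<open>c / X\<^sub>1\<^sub>2\<close>. Consequently the coefficients of both fundamental
  forms are, up to such factors, dot products or determinants of two planar vectors rotated by the
  same \<open>R\<close>, and these are rotation invariant
  (\<open>rotated_dot\<close>, \<open>rotated_det\<close>): the angle drops out. With \<open>w = x * x' + y * y'\<close> this gives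
  \<open>X\<^sub>1\<^sub>2 = \<phi> * w\<close>, so that admissibility says precisely that \<open>\<phi>\<close> and \<open>w\<close> do not vanish, and
  the coefficients of both forms become expressions in \<open>\<beta>\<close>, \<open>\<beta>'\<close>, \<open>\<beta>''\<close> alone. By the Lagrange
  identity the determinant of the first form is \<open>X\<^sub>1\<^sub>2\<^sup>2 = \<phi>\<^sup>2 * w\<^sup>2\<close>, and the two formulas follow
  by division.
\<close>

section \<open>Regularity of the generating curve\<close>

lemma has_vector_derivative_vector_3:
  fixes f g h :: "real \<Rightarrow> real"
  assumes "(f has_real_derivative f') (at s)"
    and "(g has_real_derivative g') (at s)"
    and "(h has_real_derivative h') (at s)"
  shows "((\<lambda>s. vector [f s, g s, h s] :: real^3) has_vector_derivative vector [f', g', h']) (at s)"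
proof -
  have split: "vector [a, b, d] = a *\<^sub>R axis 1 1 + b *\<^sub>R axis 2 1 + d *\<^sub>R (axis 3 1 :: real^3)"
    for a b d :: real
    by (simp add: vec_eq_iff forall_3 axis_def)
  show ?thesis
    unfolding split using assms
    by (auto intro!: derivative_eq_intros simp: has_real_derivative_iff_has_vector_derivative)
qed

lemma C1_has_vector_derivative:
  assumes "f C1_differentiable_on S" "s \<in> S"
  shows "(f has_vector_derivative vector_derivative f (at s)) (at s)"
  using assms by (auto simp: C1_differentiable_on_eq vector_derivative_works)

lemma has_real_derivative_component:
  fixes f :: "real \<Rightarrow> real^'n"
  assumes "(f has_vector_derivative f') (at s)"
  shows "((\<lambda>s. f s $ i) has_real_derivative f' $ i) (at s)"
  using bounded_linear.has_vector_derivative[OF bounded_linear_vec_nth assms]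
  by (simp add: has_real_derivative_iff_has_vector_derivative)

lemma C2_on_component:
  fixes f :: "real \<Rightarrow> real^'n"
  assumes "C2_on f S" "open S" "s \<in> S"
  shows "((\<lambda>s. f s $ i) has_real_derivative deriv (\<lambda>s. f s $ i) s) (at s)"
    and "(deriv (\<lambda>s. f s $ i) has_real_derivative deriv (deriv (\<lambda>s. f s $ i)) s) (at s)"
proof -
  let ?D = "\<lambda>s. vector_derivative f (at s)"
  have d1: "((\<lambda>s. f s $ i) has_real_derivative ?D r $ i) (at r)" if "r \<in> S" for r
    using assms(1) that
    by (intro has_real_derivative_component C1_has_vector_derivative) (auto simp: C2_on_def)
  have eq: "deriv (\<lambda>s. f s $ i) r = ?D r $ i" if "r \<in> S" for r
    using d1[OF that] by (rule DERIV_imp_deriv)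
  show "((\<lambda>s. f s $ i) has_real_derivative deriv (\<lambda>s. f s $ i) s) (at s)"
    using d1 eq \<open>s \<in> S\<close> by simp
  have "((\<lambda>s. ?D s $ i) has_real_derivative vector_derivative ?D (at s) $ i) (at s)"
    using assms(1,3)
    by (intro has_real_derivative_component C1_has_vector_derivative) (auto simp: C2_on_def)
  then have "(deriv (\<lambda>s. f s $ i) has_real_derivative vector_derivative ?D (at s) $ i) (at s)"
    by (rule has_field_derivative_transform_within_open[OF _ assms(2,3)]) (simp add: eq)
  then show "(deriv (\<lambda>s. f s $ i) has_real_derivative deriv (deriv (\<lambda>s. f s $ i)) s) (at s)"
    using DERIV_imp_deriv by fastforce
qed

lemma generating_curve_component [simp]:
  "(\<lambda>s. generating_curve x y s $ 1) = x" "(\<lambda>s. generating_curve x y s $ 2) = y"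
  by (simp_all add: generating_curve_def)

section \<open>Partial derivatives of a helicoidal surface\<close>

lemma partial_2_helicoidal:
  "partial 2 (helicoidal_ni c \<phi> x y) u t =
     vector [- \<phi> * (x u * sin (t * \<phi>) + y u * cos (t * \<phi>)),
             \<phi> * (x u * cos (t * \<phi>) - y u * sin (t * \<phi>)), c]"
  unfolding partial_def helicoidal_ni_def
  by (simp, intro vector_derivative_at has_vector_derivative_vector_3)
     (auto intro!: derivative_eq_intros simp: algebra_simps)

lemma partial_2_2_helicoidal:
  "partial 2 (partial 2 (helicoidal_ni c \<phi> x y)) u t =
     vector [- \<phi>\<^sup>2 * (x u * cos (t * \<phi>) - y u * sin (t * \<phi>)),
             - \<phi>\<^sup>2 * (x u * sin (t * \<phi>) + y u * cos (t * \<phi>)), 0]"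
  unfolding partial_def[of 2 "partial 2 _"] partial_2_helicoidal
  by (simp, intro vector_derivative_at has_vector_derivative_vector_3)
     (auto intro!: derivative_eq_intros simp: algebra_simps power2_eq_square)

lemma partial_1_helicoidal:
  assumes "(x has_real_derivative x1) (at u)" "(y has_real_derivative y1) (at u)"
  shows "partial 1 (helicoidal_ni c \<phi> x y) u t =
     vector [x1 * cos (t * \<phi>) - y1 * sin (t * \<phi>),
             x1 * sin (t * \<phi>) + y1 * cos (t * \<phi>), 0]"
  unfolding partial_def helicoidal_ni_def
  by (simp, intro vector_derivative_at has_vector_derivative_vector_3)
     (use assms in \<open>auto intro!: derivative_eq_intros\<close>)

lemma partial_1_2_helicoidal:
  assumes "(x has_real_derivative x1) (at u)" "(y has_real_derivative y1) (at u)"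
  shows "partial 1 (partial 2 (helicoidal_ni c \<phi> x y)) u t =
     vector [- \<phi> * (x1 * sin (t * \<phi>) + y1 * cos (t * \<phi>)),
             \<phi> * (x1 * cos (t * \<phi>) - y1 * sin (t * \<phi>)), 0]"
  unfolding partial_def[of 1] partial_2_helicoidal
  by (simp, intro vector_derivative_at has_vector_derivative_vector_3)
     (use assms in \<open>auto intro!: derivative_eq_intros\<close>)

text \<open>
  The first partial derivative has its closed form only where the generating curve is
  differentiable, so differentiating it again needs a whole neighbourhood of \<open>u\<close>.
\<close>

lemma partial_1_1_helicoidal:
  assumes "open S" "u \<in> S"
    and x1: "\<And>s. s \<in> S \<Longrightarrow> (x has_real_derivative x1 s) (at s)"
    and y1: "\<And>s. s \<in> S \<Longrightarrow> (y has_real_derivative y1 s) (at s)"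
    and x2: "(x1 has_real_derivative x2) (at u)"
    and y2: "(y1 has_real_derivative y2) (at u)"
  shows "partial 1 (partial 1 (helicoidal_ni c \<phi> x y)) u t =
     vector [x2 * cos (t * \<phi>) - y2 * sin (t * \<phi>),
             x2 * sin (t * \<phi>) + y2 * cos (t * \<phi>), 0]"
proof -
  have "((\<lambda>s. vector [x1 s * cos (t * \<phi>) - y1 s * sin (t * \<phi>),
                      x1 s * sin (t * \<phi>) + y1 s * cos (t * \<phi>), 0] :: real^3)
      has_vector_derivative
         vector [x2 * cos (t * \<phi>) - y2 * sin (t * \<phi>),
                 x2 * sin (t * \<phi>) + y2 * cos (t * \<phi>), 0]) (at u)"
    by (intro has_vector_derivative_vector_3)
       (use x2 y2 in \<open>auto intro!: derivative_eq_intros\<close>)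
  then have "((\<lambda>s. partial 1 (helicoidal_ni c \<phi> x y) s t) has_vector_derivative
         vector [x2 * cos (t * \<phi>) - y2 * sin (t * \<phi>),
                 x2 * sin (t * \<phi>) + y2 * cos (t * \<phi>), 0]) (at u)"
    by (rule has_vector_derivative_transform_within_open[OF _ assms(1,2)])
       (simp add: partial_1_helicoidal[OF x1 y1])
  then show ?thesis
    by (simp add: partial_def[of 1 "partial 1 _"] vector_derivative_at)
qed

section \<open>Elimination of the rotation angle\<close>

lemma rotated_dot:
  fixes a b p q \<theta> :: real
  shows "(a * cos \<theta> - b * sin \<theta>) * (p * cos \<theta> - q * sin \<theta>)
       + (a * sin \<theta> + b * cos \<theta>) * (p * sin \<theta> + q * cos \<theta>) = a * p + b * q"
  using sin_cos_squared_add[of \<theta>] by algebra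

lemma rotated_det:
  fixes a b p q \<theta> :: real
  shows "(a * cos \<theta> - b * sin \<theta>) * (p * sin \<theta> + q * cos \<theta>)
       - (a * sin \<theta> + b * cos \<theta>) * (p * cos \<theta> - q * sin \<theta>) = a * q - b * p"
  using sin_cos_squared_add[of \<theta>] by algebra

text \<open>
  The curvatures at a point depend only on the first and second partial derivatives there, so the
  values of the generating curve and of its derivatives can be free parameters. In terms of them the
  first form has coefficients \<open>x1\<^sup>2 + y1\<^sup>2\<close>, \<open>\<phi> * (x0 * y1 - x1 * y0)\<close>, \<open>\<phi>\<^sup>2 * (x0\<^sup>2 + y0\<^sup>2)\<close>,
  and the second form is \<open>c / w\<close> times \<open>(x2 * y1 - x1 * y2) / \<phi>\<close>, \<open>- (x1\<^sup>2 + y1\<^sup>2)\<close>,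
  \<open>\<phi> * (x1 * y0 - x0 * y1)\<close>.
\<close>

lemma helicoidal_curvatures:
  fixes x0 y0 x1 y1 x2 y2 w c \<phi> t u :: real and X :: surface
  defines "w \<equiv> x0 * x1 + y0 * y1" and "\<theta> \<equiv> t * \<phi>"
  assumes p1: "partial 1 X u t =
      vector [x1 * cos \<theta> - y1 * sin \<theta>, x1 * sin \<theta> + y1 * cos \<theta>, 0]"
    and p2: "partial 2 X u t =
      vector [- \<phi> * (x0 * sin \<theta> + y0 * cos \<theta>), \<phi> * (x0 * cos \<theta> - y0 * sin \<theta>), c]"
    and p11: "partial 1 (partial 1 X) u t =
      vector [x2 * cos \<theta> - y2 * sin \<theta>, x2 * sin \<theta> + y2 * cos \<theta>, 0]"
    and p12: "partial 1 (partial 2 X) u t =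
      vector [- \<phi> * (x1 * sin \<theta> + y1 * cos \<theta>), \<phi> * (x1 * cos \<theta> - y1 * sin \<theta>), 0]"
    and p22: "partial 2 (partial 2 X) u t =
      vector [- \<phi>\<^sup>2 * (x0 * cos \<theta> - y0 * sin \<theta>), - \<phi>\<^sup>2 * (x0 * sin \<theta> + y0 * cos \<theta>), 0]"
    and adm: "minor2 X 1 2 u t \<noteq> 0"
  shows "gauss_curvature X u t = c\<^sup>2 / \<phi>\<^sup>2 *
          (((x1 * y0 - x0 * y1) * (x2 * y1 - x1 * y2) - (x1\<^sup>2 + y1\<^sup>2)\<^sup>2) / w ^ 4)" (is ?K)
    and "mean_curvature X u t = c / \<phi> *
          (((x0\<^sup>2 + y0\<^sup>2) * (x2 * y1 - x1 * y2) + (x1\<^sup>2 + y1\<^sup>2) * (x0 * y1 - x1 * y0)) /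
           (2 * w ^ 3))" (is ?H)
proof -
  have m12: "minor2 X 1 2 u t = \<phi> * w"
    using rotated_dot[of x0 \<theta> y0 x1 y1] unfolding minor2_def p1 p2 w_def
    by (simp, algebra)
  have nz: "\<phi> \<noteq> 0" "w \<noteq> 0"
    using adm m12 by auto
  have m23: "minor2 X 2 3 u t = c * (x1 * sin \<theta> + y1 * cos \<theta>)"
    and m31: "minor2 X 3 1 u t = - c * (x1 * cos \<theta> - y1 * sin \<theta>)"
    unfolding minor2_def p1 p2 by simp_all
  have g11: "fund_g X 1 1 u t = x1\<^sup>2 + y1\<^sup>2"
    using rotated_dot[of x1 \<theta> y1 x1 y1]
    by (simp add: fund_g_def isotropic_inner_def p1 power2_eq_square)
  have g12: "fund_g X 1 2 u t = \<phi> * (x0 * y1 - x1 * y0)"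
    using rotated_det[of x0 \<theta> y0 x1 y1] unfolding fund_g_def isotropic_inner_def p1 p2
    by (simp, algebra)
  have g22: "fund_g X 2 2 u t = \<phi>\<^sup>2 * (x0\<^sup>2 + y0\<^sup>2)"
    using rotated_dot[of x0 \<theta> y0 x0 y0] unfolding fund_g_def isotropic_inner_def p2
    by (simp, algebra)
  \<comment> \<open>Up to scale, the planar part of the normal is the rotated tangent of the curve turned by a right angle, so pairing it with
    a planar vector is a determinant.\<close>
  have N: "inner (normal_h X u t) (vector [a, b, 0]) =
      c / (\<phi> * w) * ((x1 * sin \<theta> + y1 * cos \<theta>) * a - (x1 * cos \<theta> - y1 * sin \<theta>) * b)" for a b
    using nz unfolding normal_h_def m12 m23 m31
    by (simp add: inner_vec_def sum_3 field_simps)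
  have h11: "fund_h X 1 1 u t = c / (\<phi> * w) * (x2 * y1 - x1 * y2)"
  proof -
    have "(x1 * sin \<theta> + y1 * cos \<theta>) * (x2 * cos \<theta> - y2 * sin \<theta>)
        - (x1 * cos \<theta> - y1 * sin \<theta>) * (x2 * sin \<theta> + y2 * cos \<theta>) = x2 * y1 - x1 * y2"
      using rotated_det[of x2 \<theta> y2 x1 y1] by algebra
    then show ?thesis
      unfolding fund_h_def p11 N by simp
  qed
  have h12: "fund_h X 1 2 u t = - c / w * (x1\<^sup>2 + y1\<^sup>2)"
  proof -
    have "(x1 * sin \<theta> + y1 * cos \<theta>) * (- \<phi> * (x1 * sin \<theta> + y1 * cos \<theta>))
        - (x1 * cos \<theta> - y1 * sin \<theta>) * (\<phi> * (x1 * cos \<theta> - y1 * sin \<theta>)) = - \<phi> * (x1\<^sup>2 + y1\<^sup>2)"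
      using rotated_dot[of x1 \<theta> y1 x1 y1] by algebra
    then show ?thesis
      unfolding fund_h_def p12 N using nz by simp
  qed
  have h22: "fund_h X 2 2 u t = c * \<phi> / w * (x1 * y0 - x0 * y1)"
  proof -
    have "(x1 * sin \<theta> + y1 * cos \<theta>) * (- \<phi>\<^sup>2 * (x0 * cos \<theta> - y0 * sin \<theta>))
        - (x1 * cos \<theta> - y1 * sin \<theta>) * (- \<phi>\<^sup>2 * (x0 * sin \<theta> + y0 * cos \<theta>))
        = \<phi>\<^sup>2 * (x1 * y0 - x0 * y1)"
      using rotated_det[of x1 \<theta> y1 x0 y0] by algebra
    then show ?thesis
      unfolding fund_h_def p22 N using nz by (simp add: power2_eq_square)
  qed
  \<comment> \<open>Lagrange identity for \<open>(x0, y0)\<close> and \<open>(x1, y1)\<close>\<close>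
  have det: "fund_g X 1 1 u t * fund_g X 2 2 u t - (fund_g X 1 2 u t)\<^sup>2 = \<phi>\<^sup>2 * w\<^sup>2"
    unfolding g11 g12 g22 w_def by algebra
  have "fund_h X 1 1 u t * fund_h X 2 2 u t - (fund_h X 1 2 u t)\<^sup>2 =
      c\<^sup>2 / w\<^sup>2 * ((x1 * y0 - x0 * y1) * (x2 * y1 - x1 * y2) - (x1\<^sup>2 + y1\<^sup>2)\<^sup>2)"
  proof -
    have "c / (\<phi> * w) * a * (c * \<phi> / w * b) - (- c / w * d)\<^sup>2 = c\<^sup>2 / w\<^sup>2 * (b * a - d\<^sup>2)"
      for a b d using nz by (simp add: field_simps power2_eq_square)
    then show ?thesis unfolding h11 h12 h22 .
  qed
  moreover have "c\<^sup>2 / w\<^sup>2 * a / (\<phi>\<^sup>2 * w\<^sup>2) = c\<^sup>2 / \<phi>\<^sup>2 * (a / w ^ 4)" for a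
    using nz by (simp add: field_simps flip: power_add)
  ultimately show ?K
    unfolding gauss_curvature_def det by metis
  have "fund_g X 1 1 u t * fund_h X 2 2 u t - 2 * fund_g X 1 2 u t * fund_h X 1 2 u t
        + fund_g X 2 2 u t * fund_h X 1 1 u t =
      c * \<phi> / w * ((x0\<^sup>2 + y0\<^sup>2) * (x2 * y1 - x1 * y2) + (x1\<^sup>2 + y1\<^sup>2) * (x0 * y1 - x1 * y0))"
  proof -
    have "e * (c * \<phi> / w * (- d)) - 2 * (\<phi> * d) * (- c / w * e) + \<phi>\<^sup>2 * r * (c / (\<phi> * w) * a)
        = c * \<phi> / w * (r * a + e * d)" for a d e r
      using nz by (simp add: field_simps power2_eq_square)
    from this[of "x1\<^sup>2 + y1\<^sup>2" "x0 * y1 - x1 * y0"] show ?thesis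
      unfolding g11 g12 g22 h11 h12 h22 by simp
  qed
  moreover have "1 / 2 * (c * \<phi> / w * a / (\<phi>\<^sup>2 * w\<^sup>2)) = c / \<phi> * (a / (2 * w ^ 3))" for a
    using nz by (simp add: field_simps power2_eq_square power3_eq_cube)
  ultimately show ?H
    unfolding mean_curvature_def det by metis
qed

theorem proposition5p1:
  fixes c \<phi> :: real and x y :: "real \<Rightarrow> real" and I J :: "real set"
  assumes "open I" "is_interval I" "open J" "is_interval J"
    and "C2_on (generating_curve x y) I"
    and "admissible_on (helicoidal_ni c \<phi> x y) (I \<times> J)"
  shows "\<forall>u\<in>I. \<forall>t\<in>J.
    (let x0 = x u; x1 = deriv x u; x2 = deriv (deriv x) u;
         y0 = y u; y1 = deriv y u; y2 = deriv (deriv y) u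
     in gauss_curvature (helicoidal_ni c \<phi> x y) u t =
          c\<^sup>2 / \<phi>\<^sup>2 *
          (((x1 * y0 - x0 * y1) * (x2 * y1 - x1 * y2) - (x1\<^sup>2 + y1\<^sup>2)\<^sup>2) /
           (x0 * x1 + y0 * y1) ^ 4) \<and>
        mean_curvature (helicoidal_ni c \<phi> x y) u t =
          c / \<phi> *
          (((x0\<^sup>2 + y0\<^sup>2) * (x2 * y1 - x1 * y2) + (x1\<^sup>2 + y1\<^sup>2) * (x0 * y1 - x1 * y0)) /
           (2 * (x0 * x1 + y0 * y1) ^ 3)))"
proof (intro ballI)
  fix u t
  assume u: "u \<in> I" and t: "t \<in> J"
  note smooth_x = C2_on_component[OF assms(5,1), of _ 1, simplified]
  note smooth_y = C2_on_component[OF assms(5,1), of _ 2, simplified]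
  have adm: "minor2 (helicoidal_ni c \<phi> x y) 1 2 u t \<noteq> 0"
    using assms(6) u t by (auto simp: admissible_on_def)
  note curvatures = helicoidal_curvatures[OF
      partial_1_helicoidal[OF smooth_x(1)[OF u] smooth_y(1)[OF u]]
      partial_2_helicoidal
      partial_1_1_helicoidal[OF assms(1) u smooth_x(1) smooth_y(1) smooth_x(2)[OF u] smooth_y(2)[OF u]]
      partial_1_2_helicoidal[OF smooth_x(1)[OF u] smooth_y(1)[OF u]]
      partial_2_2_helicoidal adm]
  show "let x0 = x u; x1 = deriv x u; x2 = deriv (deriv x) u;
         y0 = y u; y1 = deriv y u; y2 = deriv (deriv y) u
     in gauss_curvature (helicoidal_ni c \<phi> x y) u t =
          c\<^sup>2 / \<phi>\<^sup>2 *
          (((x1 * y0 - x0 * y1) * (x2 * y1 - x1 * y2) - (x1\<^sup>2 + y1\<^sup>2)\<^sup>2) /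
           (x0 * x1 + y0 * y1) ^ 4) \<and>
        mean_curvature (helicoidal_ni c \<phi> x y) u t =
          c / \<phi> *
          (((x0\<^sup>2 + y0\<^sup>2) * (x2 * y1 - x1 * y2) + (x1\<^sup>2 + y1\<^sup>2) * (x0 * y1 - x1 * y0)) /
           (2 * (x0 * x1 + y0 * y1) ^ 3))"
    unfolding Let_def using curvatures by (intro conjI)
qed

end
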